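(* Let $X$ be a polyhedron space with base point $x_o$, and let $\gamma=(E,P,S(X),F,G)$ be a fiber bundle over the suspension $S(X)$ of $X$, with locally compact fiber $F$ (identified with $P^{-1}(x_o)$), which admits a lifting function $\lambda$. Let $\phi:L(S(X),x_o)\longrightarrow G$ be the map given by $$\phi(\beta)(x)=\Theta_{\lambda}(\beta,x)\qquad\text{for all } \beta\in L(S(X),x_o),\ x\in F,$$ where $\Theta_\lambda$ is the $Sf$-function induced by $\lambda$. Then $\phi\circ\psi\simeq\mu$ (the maps $\phi\circ\psi,\mu:X\to G$ are homotopic), where $\mu:(X,x_o)\longrightarrow (G,e)$ is the characteristic map of $\gamma$ and $\psi:X\to L(S(X),x_o)$ is the conical map.
   Context: "Space" means Hausdorff topological space; "map" means continuous function; $\simeq$ denotes homotopy. $I=[0,1]$. Path spaces $B^I$, $E^I$ and mapping spaces such as $F^F$ carry the compact-open topology. Suspension: $S(X)$ is the quotient space of $X\times I$ in which, for all $x\in X$, $(x,0)$ is identified with $(x_o,0)$ and $(x,1)$ with $(x_o,1)$; $X\times\{1/2\}$ is identified with $X$, so $X\subset S(X)$ and $x_o\in S(X)$. $S(X)$ is the union of two cones $C_0(X)$ (the image of $X\times[0,1/2]$) and $C_1(X)$ (the image of $X\times[1/2,1]$), with $C_0(X)\cap C_1(X)=X$. Fiber bundle: let $E,B,F$ be spaces, $P:E\to B$ a map of $E$ onto $B$, and $G$ the group of all homeomorphisms of $F$ onto $F$ under composition, with identity $e$ (with the compact-open topology, $G\subset F^F$). Then $(E,P,B,F,G)$ is a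 fiber bundle over the base $B$ if there is an open covering $\{V_j: j\in\Lambda\}$ of $B$ and for each $j\in\Lambda$ a homeomorphism $\theta_j:V_j\times F\to P^{-1}(V_j)$ (coordinate function) such that: (1) $P[\theta_j(b,y)]=b$ for all $b\in V_j$, $y\in F$; (2) for each $i,j\in\Lambda$ and $b\in V_i\cap V_j$, the homeomorphism $\theta_{jb}^{-1}\circ\theta_{ib}:F\to F$ corresponds to an element of $G$, where $\theta_{kb}:F\to P^{-1}(b)$, $\theta_{kb}(y)=\theta_k(b,y)$; (3) for each $i,j\in\Lambda$ the function $g_{ij}:V_i\cap V_j\to G$, $g_{ij}(b)=\theta_{jb}^{-1}\circ\theta_{ib}$, is continuous. Characteristic map: for a fiber bundle over $S(X)$, take fiber-preserving homeomorphisms $\epsilon_1:C_0(X)\times F\to P^{-1}(C_0(X))$ and $\epsilon_2:C_1(X)\times F\to P^{-1}(C_1(X))$ over the two cones (trivializations of the bundle) agreeing over $x_o$, i.e. $\epsilon_1(x_o,y)=\epsilon_2(x_o,y)$ for $y\in F$. The characteristic map $\mu:(X,x_o)\to(G,e)$ is the map with $\epsilon_2(x,y)=\epsilon_1(x,\mu(x)(y))$ for $x\in X$, $y\in F$; thus $\mu(x_o)=e$. The fiber $F$ is identified with $P^{-1}(x_o)$ via $y\mapsto\epsilon_1(x_o,y)=\epsilon_2(x_o,y)$. A lifting function for $P:E\to B$ is a continuous map $\lambda:\{(e,w)\in E\times B^I: P(e)=w(0)\}\to E^I$ with $\lambda(e,w)(0)=e$ and $P\circ\lambda(e,w)=w$.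 $L(B,b_o)\subset B^I$ is the space of all loops in $B$ based at $b_o$. The $Sf$-function induced by $\lambda$ is the map $\Theta_\lambda:L(B,b_o)\times P^{-1}(b_o)\to P^{-1}(b_o)$, $\Theta_\lambda(\alpha,e)=\lambda(e,\alpha)(1)$. Conical map: each of the cones $C_0(X)$, $C_1(X)$ can be contracted on itself to $x_o$ leaving $x_o$ fixed. For $x\in X$ let $w_0(x)$ be the path from $x$ to $x_o$ in $C_0(X)$ and $w_1(x)$ the path from $x$ to $x_o$ in $C_1(X)$ given by such contractions (so they depend continuously on $x$). The conical map $\psi:X\to L(S(X),x_o)$ is $\psi(x)=\overline{w_1(x)}\star w_0(x)$, where $\overline{\alpha}$ is the inverse path of $\alpha$ and $\alpha\star\beta$ denotes the path that traverses first $\alpha$ on $[0,1/2]$ and then $\beta$ on $[1/2,1]$; in particular $\psi(x)(1/2)=x$.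
   Formalization: For an arbitrary lifting function the homotopy φ∘ψ ≃ μ is proved in F^F, not in G; it is proved in G under the added assumption that each λ(-,β)(t), β a loop at x_o, is a homeomorphism of fibers. Without it the claim in G fails (X a point, F=R, λ((b,r),w)(t)=(w(t),r(1-2t))). *)

theory Defs
  imports "HOL-Analysis.Analysis"
begin

section \<open>Mapping spaces\<close>

text \<open>A continuous map out of \<open>X\<close> is represented by the function that is \<open>undefined\<close> off
  \<open>topspace X\<close>, so that points of the mapping space are exactly the continuous maps.\<close>

definition compact_open :: "'a topology \<Rightarrow> 'b topology \<Rightarrow> ('a \<Rightarrow> 'b) topology" where
  "compact_open X Y = topology_generated_by
     {{f \<in> extensional (topspace X). continuous_map X Y f \<and> f ` K \<subseteq> U} | K U.
        compactin X K \<and> openin Y U}"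

lemma topspace_compact_open:
  "topspace (compact_open X Y) = {f \<in> extensional (topspace X). continuous_map X Y f}"
proof -
  have "{f \<in> extensional (topspace X). continuous_map X Y f \<and> f ` {} \<subseteq> {}} \<in>
    {{f \<in> extensional (topspace X). continuous_map X Y f \<and> f ` K \<subseteq> U} | K U.
        compactin X K \<and> openin Y U}"
    by blast
  then show ?thesis
    unfolding compact_open_def topology_generated_by_topspace by auto
qed

definition homeo_group :: "'a topology \<Rightarrow> ('a \<Rightarrow> 'a) topology" where
  "homeo_group F = subtopology (compact_open F F) {g. homeomorphic_map F F g}"

abbreviation unit_interval :: "real topology" where
  "unit_interval \<equiv> top_of_set {0..1}"

abbreviation path_space :: "'a topology \<Rightarrow> (real \<Rightarrow> 'a) topology" where
  "path_space B \<equiv> compact_open unit_interval B"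

definition loop_space :: "'a topology \<Rightarrow> 'a \<Rightarrow> (real \<Rightarrow> 'a) topology" where
  "loop_space B b = subtopology (path_space B) {w. w 0 = b \<and> w 1 = b}"

definition path_inverse :: "(real \<Rightarrow> 'a) \<Rightarrow> real \<Rightarrow> 'a" where
  "path_inverse w = restrict (\<lambda>t. w (1 - t)) {0..1}"

definition path_join :: "(real \<Rightarrow> 'a) \<Rightarrow> (real \<Rightarrow> 'a) \<Rightarrow> real \<Rightarrow> 'a" where
  "path_join v w = restrict (\<lambda>t. if t \<le> 1/2 then v (2 * t) else w (2 * t - 1)) {0..1}"

section \<open>Polyhedra\<close>

definition abstract_simplicial_complex :: "'v set set \<Rightarrow> bool" where
  "abstract_simplicial_complex K \<longleftrightarrow>
     (\<forall>s\<in>K. finite s \<and> s \<noteq> {}) \<and> (\<forall>s\<in>K. \<forall>t. t \<subseteq> s \<and> t \<noteq> {} \<longrightarrow> t \<in> K)"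

text \<open>Points of the realization are given by their barycentric coordinates.\<close>

definition realization_points :: "'v set set \<Rightarrow> ('v \<Rightarrow> real) set" where
  "realization_points K =
     {p. (\<forall>v. 0 \<le> p v) \<and> {v. p v \<noteq> 0} \<in> K \<and> sum p {v. p v \<noteq> 0} = 1}"

definition closed_simplex :: "'v set set \<Rightarrow> 'v set \<Rightarrow> ('v \<Rightarrow> real) set" where
  "closed_simplex K s = {p \<in> realization_points K. {v. p v \<noteq> 0} \<subseteq> s}"

text \<open>The weak topology: a set is open iff it meets every closed simplex in an open set of that
  simplex. For a finite complex this is the Euclidean topology.\<close>

definition realization :: "'v set set \<Rightarrow> ('v \<Rightarrow> real) topology" where
  "realization K = topology (\<lambda>U. U \<subseteq> realization_points K \<and>
     (\<forall>s\<in>K. openin (subtopology (product_topology (\<lambda>_. euclideanreal) UNIV) (closed_simplex K s))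
               (U \<inter> closed_simplex K s)))"

lemma openin_realization:
  "openin (realization K) U \<longleftrightarrow> U \<subseteq> realization_points K \<and>
     (\<forall>s\<in>K. openin (subtopology (product_topology (\<lambda>_. euclideanreal) UNIV) (closed_simplex K s))
               (U \<inter> closed_simplex K s))"
proof -
  have "istopology (\<lambda>U. U \<subseteq> realization_points K \<and>
     (\<forall>s\<in>K. openin (subtopology (product_topology (\<lambda>_. euclideanreal) UNIV) (closed_simplex K s))
               (U \<inter> closed_simplex K s)))"
    unfolding istopology_def
  proof (intro conjI allI impI)
    fix S T
    assume S: "S \<subseteq> realization_points K \<and>
     (\<forall>s\<in>K. openin (subtopology (product_topology (\<lambda>_. euclideanreal) UNIV) (closed_simplex K s))
               (S \<inter> closed_simplex K s))"
      and T: "T \<subseteq> realization_points K \<and>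
     (\<forall>s\<in>K. openin (subtopology (product_topology (\<lambda>_. euclideanreal) UNIV) (closed_simplex K s))
               (T \<inter> closed_simplex K s))"
    show "S \<inter> T \<subseteq> realization_points K"
      using S by blast
    show "\<forall>s\<in>K. openin (subtopology (product_topology (\<lambda>_. euclideanreal) UNIV) (closed_simplex K s))
               (S \<inter> T \<inter> closed_simplex K s)"
    proof
      fix s assume s: "s \<in> K"
      have eq: "S \<inter> T \<inter> closed_simplex K s = (S \<inter> closed_simplex K s) \<inter> (T \<inter> closed_simplex K s)"
        by blast
      show "openin (subtopology (product_topology (\<lambda>_. euclideanreal) UNIV) (closed_simplex K s))
               (S \<inter> T \<inter> closed_simplex K s)"
        unfolding eq
        by (rule openin_Int[OF bspec[OF conjunct2[OF S] s] bspec[OF conjunct2[OF T] s]])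
    qed
  next
    fix \<K> :: "('a \<Rightarrow> real) set set"
    assume *: "\<forall>U\<in>\<K>. U \<subseteq> realization_points K \<and>
     (\<forall>s\<in>K. openin (subtopology (product_topology (\<lambda>_. euclideanreal) UNIV) (closed_simplex K s))
               (U \<inter> closed_simplex K s))"
    then show "\<Union>\<K> \<subseteq> realization_points K"
      by blast
    show "\<forall>s\<in>K. openin (subtopology (product_topology (\<lambda>_. euclideanreal) UNIV) (closed_simplex K s))
               (\<Union>\<K> \<inter> closed_simplex K s)"
    proof
      fix s assume s: "s \<in> K"
      have eq: "\<Union>\<K> \<inter> closed_simplex K s = \<Union>((\<lambda>U. U \<inter> closed_simplex K s) ` \<K>)"
        by blast
      show "openin (subtopology (product_topology (\<lambda>_. euclideanreal) UNIV) (closed_simplex K s))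
               (\<Union>\<K> \<inter> closed_simplex K s)"
        unfolding eq
      proof (rule openin_Union)
        fix W assume "W \<in> (\<lambda>U. U \<inter> closed_simplex K s) ` \<K>"
        then obtain U where U: "U \<in> \<K>" and W: "W = U \<inter> closed_simplex K s"
          by (rule imageE)
        show "openin (subtopology (product_topology (\<lambda>_. euclideanreal) UNIV) (closed_simplex K s)) W"
          unfolding W by (rule bspec[OF conjunct2[OF bspec[OF * U]] s])
      qed
    qed
  qed
  then show ?thesis
    by (simp add: realization_def)
qed

text \<open>Every vertex of a complex is a point of its realization, so taking the vertices among the
  points of \<open>X\<close> is no loss of generality.\<close>

definition polyhedron_space :: "'a topology \<Rightarrow> bool" where
  "polyhedron_space X \<longleftrightarrow>
     (\<exists>K :: 'a set set. abstract_simplicial_complex K \<and> X homeomorphic_space realization K)"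

section \<open>Suspension\<close>

definition quotient_topology :: "'a topology \<Rightarrow> ('a \<Rightarrow> 'b) \<Rightarrow> 'b topology" where
  "quotient_topology X q =
     topology (\<lambda>U. U \<subseteq> q ` topspace X \<and> openin X {x \<in> topspace X. q x \<in> U})"

lemma openin_quotient_topology:
  "openin (quotient_topology X q) U \<longleftrightarrow>
     U \<subseteq> q ` topspace X \<and> openin X {x \<in> topspace X. q x \<in> U}"
proof -
  have "istopology (\<lambda>U. U \<subseteq> q ` topspace X \<and> openin X {x \<in> topspace X. q x \<in> U})"
    unfolding istopology_def
  proof (intro conjI allI impI)
    fix S T
    assume S: "S \<subseteq> q ` topspace X \<and> openin X {x \<in> topspace X. q x \<in> S}"
      and T: "T \<subseteq> q ` topspace X \<and> openin X {x \<in> topspace X. q x \<in> T}"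
    show "S \<inter> T \<subseteq> q ` topspace X"
      using S by blast
    have eq: "{x \<in> topspace X. q x \<in> S \<inter> T} =
        {x \<in> topspace X. q x \<in> S} \<inter> {x \<in> topspace X. q x \<in> T}"
      by blast
    show "openin X {x \<in> topspace X. q x \<in> S \<inter> T}"
      unfolding eq by (rule openin_Int[OF conjunct2[OF S] conjunct2[OF T]])
  next
    fix \<K>
    assume *: "\<forall>U\<in>\<K>. U \<subseteq> q ` topspace X \<and> openin X {x \<in> topspace X. q x \<in> U}"
    then show "\<Union>\<K> \<subseteq> q ` topspace X"
      by blast
    have "{x \<in> topspace X. q x \<in> \<Union>\<K>} = (\<Union>U\<in>\<K>. {x \<in> topspace X. q x \<in> U})"
      by blast
    then show "openin X {x \<in> topspace X. q x \<in> \<Union>\<K>}"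
      using * by (auto intro!: openin_Union)
  qed
  then show ?thesis
    by (simp add: quotient_topology_def)
qed

lemma quotient_map_quotient_topology: "quotient_map X (quotient_topology X q) q"
proof -
  have eq: "{x \<in> topspace X. q x \<in> q ` topspace X} = topspace X"
    by blast
  have "openin (quotient_topology X q) (q ` topspace X)"
    unfolding openin_quotient_topology eq by simp
  moreover have "topspace (quotient_topology X q) \<subseteq> q ` topspace X"
    using openin_topspace[of "quotient_topology X q"] unfolding openin_quotient_topology
    by (rule conjunct1)
  ultimately have "topspace (quotient_topology X q) = q ` topspace X"
    by (simp add: openin_subset subset_antisym)
  then show ?thesis
    by (simp add: quotient_map_def openin_quotient_topology)
qed

text \<open>Each point of the suspension is represented by a point of \<open>X \<times> I\<close>: the two poles by
  \<open>(x0, 0)\<close> and \<open>(x0, 1)\<close>, any other point by itself.\<close>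

definition susp_proj :: "'a \<Rightarrow> 'a \<times> real \<Rightarrow> 'a \<times> real" where
  "susp_proj x0 = (\<lambda>(x, t). if t = 0 \<or> t = 1 then (x0, t) else (x, t))"

definition suspension :: "'a topology \<Rightarrow> 'a \<Rightarrow> ('a \<times> real) topology" where
  "suspension X x0 = quotient_topology (prod_topology X unit_interval) (susp_proj x0)"

definition susp_incl :: "'a \<Rightarrow> 'a \<times> real" where
  "susp_incl x = (x, 1/2)"

definition cone0 :: "'a topology \<Rightarrow> 'a \<Rightarrow> ('a \<times> real) set" where
  "cone0 X x0 = susp_proj x0 ` (topspace X \<times> {0..1/2})"

definition cone1 :: "'a topology \<Rightarrow> 'a \<Rightarrow> ('a \<times> real) set" where
  "cone1 X x0 = susp_proj x0 ` (topspace X \<times> {1/2..1})"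

text \<open>A contraction of the space \<open>C\<close> on itself to \<open>z\<close> leaving \<open>z\<close> fixed.\<close>

definition contraction_to :: "'a topology \<Rightarrow> 'a \<Rightarrow> ('a \<times> real \<Rightarrow> 'a) \<Rightarrow> bool" where
  "contraction_to C z H \<longleftrightarrow>
     continuous_map (prod_topology C unit_interval) C H \<and>
     (\<forall>c\<in>topspace C. H (c, 0) = c \<and> H (c, 1) = z) \<and> (\<forall>t\<in>{0..1}. H (z, t) = z)"

definition contraction_path :: "('a \<times> real \<Rightarrow> 'a) \<Rightarrow> 'a \<Rightarrow> real \<Rightarrow> 'a" where
  "contraction_path H c = restrict (\<lambda>t. H (c, t)) {0..1}"

definition conical_map ::
  "(('a \<times> real) \<times> real \<Rightarrow> 'a \<times> real) \<Rightarrow> (('a \<times> real) \<times> real \<Rightarrow> 'a \<times> real) \<Rightarrow> 'a \<Rightarrow> real \<Rightarrow> 'a \<times> real"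
where
  "conical_map H0 H1 x =
     path_join (path_inverse (contraction_path H1 (susp_incl x))) (contraction_path H0 (susp_incl x))"

section \<open>Fiber bundles and lifting functions\<close>

definition trivialization ::
  "'e topology \<Rightarrow> ('e \<Rightarrow> 'b) \<Rightarrow> 'b topology \<Rightarrow> 'f topology \<Rightarrow> 'b set \<Rightarrow> ('b \<times> 'f \<Rightarrow> 'e) \<Rightarrow> bool"
where
  "trivialization E P B F V \<theta> \<longleftrightarrow>
     homeomorphic_map (prod_topology (subtopology B V) F)
       (subtopology E {e \<in> topspace E. P e \<in> V}) \<theta> \<and>
     (\<forall>b\<in>V. \<forall>y\<in>topspace F. P (\<theta> (b, y)) = b)"

text \<open>\<open>transition F \<theta>i \<theta>j b\<close> is \<open>\<theta>jb\<inverse> \<circ> \<theta>ib\<close>.\<close>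

definition transition ::
  "'f topology \<Rightarrow> ('b \<times> 'f \<Rightarrow> 'e) \<Rightarrow> ('b \<times> 'f \<Rightarrow> 'e) \<Rightarrow> 'b \<Rightarrow> 'f \<Rightarrow> 'f"
where
  "transition F \<theta>i \<theta>j b =
     restrict (\<lambda>y. inv_into (topspace F) (\<lambda>z. \<theta>j (b, z)) (\<theta>i (b, y))) (topspace F)"

text \<open>The structure group is the full homeomorphism group of the fiber. The coordinate system
  \<open>A\<close> is a set of pairs \<open>(V, \<theta>)\<close>, which serves as its own index set.\<close>

definition fiber_bundle ::
  "'e topology \<Rightarrow> ('e \<Rightarrow> 'b) \<Rightarrow> 'b topology \<Rightarrow> 'f topology \<Rightarrow> bool"
where
  "fiber_bundle E P B F \<longleftrightarrow>
     Hausdorff_space E \<and> Hausdorff_space B \<and> Hausdorff_space F \<and>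
     continuous_map E B P \<and> P ` topspace E = topspace B \<and>
     (\<exists>A :: ('b set \<times> ('b \<times> 'f \<Rightarrow> 'e)) set.
        (\<Union>(V, \<theta>)\<in>A. V) = topspace B \<and>
        (\<forall>(V, \<theta>)\<in>A. openin B V \<and> trivialization E P B F V \<theta>) \<and>
        (\<forall>(Vi, \<theta>i)\<in>A. \<forall>(Vj, \<theta>j)\<in>A.
           (\<forall>b\<in>Vi \<inter> Vj. transition F \<theta>i \<theta>j b \<in> topspace (homeo_group F)) \<and>
           continuous_map (subtopology B (Vi \<inter> Vj)) (homeo_group F) (transition F \<theta>i \<theta>j)))"

definition fiber :: "'e topology \<Rightarrow> ('e \<Rightarrow> 'b) \<Rightarrow> 'b \<Rightarrow> 'e set" where
  "fiber E P b = {e \<in> topspace E. P e = b}"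

definition lifting_function ::
  "'e topology \<Rightarrow> ('e \<Rightarrow> 'b) \<Rightarrow> 'b topology \<Rightarrow> ('e \<times> (real \<Rightarrow> 'b) \<Rightarrow> real \<Rightarrow> 'e) \<Rightarrow> bool"
where
  "lifting_function E P B \<Lambda> \<longleftrightarrow>
     continuous_map (subtopology (prod_topology E (path_space B)) {(e, w). P e = w 0})
       (path_space E) \<Lambda> \<and>
     (\<forall>e\<in>topspace E. \<forall>w\<in>topspace (path_space B). P e = w 0 \<longrightarrow>
        \<Lambda> (e, w) 0 = e \<and> (\<forall>t\<in>{0..1}. P (\<Lambda> (e, w) t) = w t))"

definition Sf_function ::
  "('e \<times> (real \<Rightarrow> 'b) \<Rightarrow> real \<Rightarrow> 'e) \<Rightarrow> (real \<Rightarrow> 'b) \<times> 'e \<Rightarrow> 'e"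
where
  "Sf_function \<Lambda> = (\<lambda>(\<alpha>, e). \<Lambda> (e, \<alpha>) 1)"

text \<open>The function \<open>y \<mapsto> \<Theta> (\<beta>, y)\<close> of \<open>F\<close> into itself, where \<open>j\<close> is the map of \<open>F\<close> onto
  the fiber over the base point by which the two are identified. For an arbitrary lifting
  function this need not be a homeomorphism, so \<open>\<beta> \<mapsto> Sf_action F j \<Lambda> \<beta>\<close> takes its values
  in \<open>F\<^sup>F = compact_open F F\<close>, of which \<open>homeo_group F\<close> is a subspace.\<close>

definition Sf_action ::
  "'f topology \<Rightarrow> ('f \<Rightarrow> 'e) \<Rightarrow> ('e \<times> (real \<Rightarrow> 'b) \<Rightarrow> real \<Rightarrow> 'e) \<Rightarrow> (real \<Rightarrow> 'b) \<Rightarrow> 'f \<Rightarrow> 'f"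
where
  "Sf_action F j \<Lambda> \<beta> =
     restrict (\<lambda>y. inv_into (topspace F) j (Sf_function \<Lambda> (\<beta>, j y))) (topspace F)"

definition characteristic_map ::
  "'a topology \<Rightarrow> 'f topology \<Rightarrow> (('a \<times> real) \<times> 'f \<Rightarrow> 'e) \<Rightarrow> (('a \<times> real) \<times> 'f \<Rightarrow> 'e)
     \<Rightarrow> ('a \<Rightarrow> 'f \<Rightarrow> 'f) \<Rightarrow> bool"
where
  "characteristic_map X F \<epsilon>1 \<epsilon>2 \<mu> \<longleftrightarrow>
     continuous_map X (homeo_group F) \<mu> \<and>
     (\<forall>x\<in>topspace X. \<forall>y\<in>topspace F. \<epsilon>2 (susp_incl x, y) = \<epsilon>1 (susp_incl x, \<mu> x y))"

end

theory Submission
  imports Defs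
begin

text \<open>
  The loop \<open>\<psi> x\<close> runs from the base point \<open>b = susp_incl x0\<close> through the cone \<open>C1\<close> to \<open>x\<close>, which
  it reaches at time \<open>1/2\<close>, and then through \<open>C0\<close> back to \<open>b\<close>. Let \<open>l t x y\<close> be the point at time
  \<open>t\<close> of the lift of \<open>\<psi> x\<close> that starts at the point \<open>y\<close> of the fiber over \<open>b\<close>. For \<open>t \<le> 1/2\<close> it
  lies over \<open>C1\<close> and has a fiber coordinate \<open>k1\<close> with respect to \<open>\<epsilon>2\<close>; for \<open>t \<ge> 1/2\<close> it lies over
  \<open>C0\<close> and has a fiber coordinate \<open>k0\<close> with respect to \<open>\<epsilon>1\<close>. The homotopy from \<open>\<mu>\<close> to
  \<open>\<phi> \<circ> \<psi>\<close> follows the lift and reads off its coordinate,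

    \<open>t \<le> 1/2: y \<mapsto> \<mu> x (k1 (l t x y))\<close>,  \<open>t \<ge> 1/2: y \<mapsto> k0 (l t x y)\<close>.

  At time \<open>0\<close> the lift is at \<open>y\<close>, and the two trivializations agree over \<open>b\<close>, so the value is
  \<open>\<mu> x\<close>; at time \<open>1\<close> it is the coordinate of the end point of the lift, which is \<open>\<phi> (\<psi> x) y\<close>. At
  time \<open>1/2\<close> the lift is over \<open>x\<close>, and the two formulas agree there because
  \<open>\<epsilon>2 (x, z) = \<epsilon>1 (x, \<mu> x z)\<close> is what defines \<open>\<mu>\<close>.

  Continuity is the exponential law for the compact-open topology. Maps depending jointly
  continuously on a parameter and a point give continuous maps into the mapping space
  (\<open>continuous_map_curry\<close>). Conversely evaluation is continuous on a locally compact Hausdorff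
  space (\<open>continuous_map_evaluation\<close>); this is applied to paths, whose domain is the unit interval,
  to see that \<open>l\<close> is jointly continuous, and to \<open>F\<close>, to see that \<open>\<mu> x (k1 (l t x y))\<close> is.

  If the translations of fibers along loops are homeomorphisms, then each stage of the homotopy is
  a composite of homeomorphisms (a trivialization over \<open>b\<close>, a translation, a fiber coordinate and
  possibly \<open>\<mu> x\<close>), so the same homotopy takes place in the homeomorphism group.
\<close>

section \<open>The exponential law for the compact-open topology\<close>

text \<open>For compact \<open>K\<close> and open \<open>U\<close>, the parameters \<open>x\<close> with \<open>f (x, _) ` K \<subseteq> U\<close> form an open set by
  the tube lemma, applied to \<open>{x} \<times> K\<close> inside the open set of all points that \<open>f\<close> sends to \<open>U\<close>.\<close>

lemma continuous_map_curry:
  assumes f: "continuous_map (prod_topology X Y) Z f"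
  shows "continuous_map X (compact_open Y Z) (\<lambda>x. restrict (\<lambda>y. f (x, y)) (topspace Y))"
proof -
  let ?g = "\<lambda>x. restrict (\<lambda>y. f (x, y)) (topspace Y)"
  have cont: "continuous_map Y Z (?g x)" if "x \<in> topspace X" for x
  proof (rule continuous_map_eq)
    show "continuous_map Y Z (f \<circ> Pair x)"
      by (intro continuous_map_compose[OF _ f] continuous_map_pairedI) (use that in auto)
  qed auto
  show ?thesis
    unfolding compact_open_def
  proof (rule continuous_on_generated_topo)
    fix W
    assume "W \<in> {{f \<in> extensional (topspace Y). continuous_map Y Z f \<and> f ` K \<subseteq> U} | K U.
        compactin Y K \<and> openin Z U}"
    then obtain K U where K: "compactin Y K" and U: "openin Z U"
      and W: "W = {f \<in> extensional (topspace Y). continuous_map Y Z f \<and> f ` K \<subseteq> U}"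
      by blast
    have KY: "K \<subseteq> topspace Y"
      using K by (rule compactin_subset_topspace)
    let ?N = "{p \<in> topspace (prod_topology X Y). f p \<in> U}"
    have N: "openin (prod_topology X Y) ?N"
      using f U by (rule openin_continuous_map_preimage)
    show "openin X (?g -` W \<inter> topspace X)"
    proof (subst openin_subopen, intro ballI)
      fix x
      assume "x \<in> ?g -` W \<inter> topspace X"
      then have x: "x \<in> topspace X" and "?g x ` K \<subseteq> U"
        by (auto simp: W)
      then have "{x} \<times> K \<subseteq> ?N"
        using KY by auto
      then obtain T V where T: "openin X T" "x \<in> T" "K \<subseteq> V" "T \<times> V \<subseteq> ?N"
        using Wallace_theorem_prod_topology[OF _ K N, of "{x}"] x
        by (metis compactin_sing insert_subset)
      have "T \<subseteq> ?g -` W \<inter> topspace X"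
      proof
        fix x' assume x': "x' \<in> T"
        then have "x' \<in> topspace X"
          using T(1) openin_subset by blast
        moreover have "?g x' ` K \<subseteq> U"
          using T(3,4) x' KY by fastforce
        ultimately show "x' \<in> ?g -` W \<inter> topspace X"
          using cont by (auto simp: W)
      qed
      with T show "\<exists>T. openin X T \<and> x \<in> T \<and> T \<subseteq> ?g -` W \<inter> topspace X"
        by blast
    qed
  next
    show "?g ` topspace X \<subseteq> \<Union> {{f \<in> extensional (topspace Y). continuous_map Y Z f \<and> f ` K \<subseteq> U} | K U.
        compactin Y K \<and> openin Z U}"
      using topspace_compact_open[of Y Z] cont
      unfolding compact_open_def topology_generated_by_topspace by (auto simp: set_eq_iff)
  qed
qed

lemma openin_compact_open_subbasic:
  assumes "compactin X K" "openin Y U"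
  shows "openin (compact_open X Y)
    {f \<in> extensional (topspace X). continuous_map X Y f \<and> f ` K \<subseteq> U}"
  unfolding compact_open_def
  by (rule topology_generated_by_Basis) (use assms in blast)

text \<open>If \<open>f y \<in> U\<close>, local compactness provides a compact neighbourhood \<open>K\<close> of \<open>y\<close> with
  \<open>f ` K \<subseteq> U\<close>. All maps that send \<open>K\<close> into \<open>U\<close> then send every point near \<open>y\<close> into \<open>U\<close>.\<close>

lemma continuous_map_evaluation:
  assumes Y: "locally_compact_space Y" "Hausdorff_space Y"
  shows "continuous_map (prod_topology (compact_open Y Z) Y) Z (\<lambda>(f, y). f y)"
  unfolding continuous_map_def
proof (intro conjI allI impI)
  show "(\<lambda>(f, y). f y) \<in> topspace (prod_topology (compact_open Y Z) Y) \<rightarrow> topspace Z"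
    by (auto simp: topspace_compact_open dest: continuous_map_image_subset_topspace)
  fix U assume U: "openin Z U"
  let ?N = "{p \<in> topspace (prod_topology (compact_open Y Z) Y). (case p of (f, y) \<Rightarrow> f y) \<in> U}"
  show "openin (prod_topology (compact_open Y Z) Y) ?N"
    unfolding openin_prod_topology_alt
  proof (intro allI impI)
    fix f y assume "(f, y) \<in> ?N"
    then have f: "f \<in> extensional (topspace Y)" "continuous_map Y Z f"
      and y: "y \<in> topspace Y" "f y \<in> U"
      by (auto simp: topspace_compact_open)
    have "neighbourhood_base_of (compactin Y) Y"
      using Y locally_compact_space_neighbourhood_base by blast
    moreover have "openin Y {z \<in> topspace Y. f z \<in> U}"
      using f(2) U by (rule openin_continuous_map_preimage)
    ultimately obtain V K where VK: "openin Y V" "compactin Y K" "y \<in> V" "V \<subseteq> K"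
        "K \<subseteq> {z \<in> topspace Y. f z \<in> U}"
      unfolding neighbourhood_base_of using y by (metis (no_types, lifting) mem_Collect_eq)
    let ?W = "{f \<in> extensional (topspace Y). continuous_map Y Z f \<and> f ` K \<subseteq> U}"
    have "openin (compact_open Y Z) ?W"
      using VK(2) U by (rule openin_compact_open_subbasic)
    moreover have "f \<in> ?W"
      using f VK(5) by auto
    moreover have "?W \<times> V \<subseteq> ?N"
      using VK by (auto simp: topspace_compact_open)
    ultimately show "\<exists>W V. openin (compact_open Y Z) W \<and> openin Y V \<and> f \<in> W \<and> y \<in> V \<and> W \<times> V \<subseteq> ?N"
      using VK(1,3) by blast
  qed
qed

lemma continuous_map_eval:
  assumes "locally_compact_space Y" "Hausdorff_space Y"
    and "continuous_map W (compact_open Y Z) f" "continuous_map W Y y"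
  shows "continuous_map W Z (\<lambda>w. f w (y w))"
proof -
  have "continuous_map W Z ((\<lambda>(f, y). f y) \<circ> (\<lambda>w. (f w, y w)))"
    by (intro continuous_map_compose[OF _ continuous_map_evaluation[OF assms(1,2)]]
        continuous_map_pairedI assms(3,4))
  then show ?thesis
    by (simp add: o_def)
qed

text \<open>The set \<open>A\<close> allows one homotopy to be read both in the full mapping space and, when its stages
  are homeomorphisms, in the homeomorphism group.\<close>

lemma homotopic_with_curry:
  assumes h: "continuous_map (prod_topology (prod_topology unit_interval X) Y) Z (\<lambda>((t, x), y). h t x y)"
    and A: "\<And>t x. t \<in> {0..1} \<Longrightarrow> x \<in> topspace X \<Longrightarrow> restrict (h t x) (topspace Y) \<in> A"
    and f: "\<And>x. x \<in> topspace X \<Longrightarrow> f x = restrict (h 0 x) (topspace Y)"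
    and g: "\<And>x. x \<in> topspace X \<Longrightarrow> g x = restrict (h 1 x) (topspace Y)"
  shows "homotopic_with (\<lambda>_. True) X (subtopology (compact_open Y Z) A) f g"
proof -
  have "continuous_map (prod_topology unit_interval X) (compact_open Y Z)
      (\<lambda>(t, x). restrict (h t x) (topspace Y))"
    using continuous_map_curry[OF h] by (simp add: case_prod_unfold)
  then have "continuous_map (prod_topology unit_interval X) (subtopology (compact_open Y Z) A)
      (\<lambda>(t, x). restrict (h t x) (topspace Y))"
    by (rule continuous_map_into_subtopology) (use A in auto)
  then show ?thesis
    by (subst homotopic_with, simp) (use f g in force)
qed

section \<open>Lifts of families of paths\<close>

lemma unit_interval_locally_compact: "locally_compact_space unit_interval"
  by (simp add: compact_imp_locally_compact_space compact_space_subtopology compactin_euclidean_iff)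

lemma unit_interval_Hausdorff: "Hausdorff_space unit_interval"
  by (simp add: Hausdorff_space_subtopology)

text \<open>A lifting function is continuous as a map into a path space; evaluating the lifted paths keeps
  continuity because the unit interval is compact.\<close>

lemma continuous_map_lift:
  assumes \<Lambda>: "lifting_function E P B \<Lambda>"
    and a: "continuous_map W E a" and w: "continuous_map W (path_space B) w"
    and t: "continuous_map W unit_interval t"
    and start: "\<And>z. z \<in> topspace W \<Longrightarrow> P (a z) = w z 0"
  shows "continuous_map W E (\<lambda>z. \<Lambda> (a z, w z) (t z))"
proof (rule continuous_map_eval[OF unit_interval_locally_compact unit_interval_Hausdorff _ t])
  have "continuous_map W (path_space E) (\<Lambda> \<circ> (\<lambda>z. (a z, w z)))"
  proof (rule continuous_map_compose)
    show "continuous_map W (subtopology (prod_topology E (path_space B)) {(e, w). P e = w 0})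
        (\<lambda>z. (a z, w z))"
      by (intro continuous_map_into_subtopology continuous_map_pairedI a w) (use start in auto)
  qed (use \<Lambda> in \<open>simp add: lifting_function_def\<close>)
  then show "continuous_map W (path_space E) (\<lambda>z. \<Lambda> (a z, w z))"
    by (simp add: o_def)
qed

section \<open>Fiber coordinates in a trivialization\<close>

text \<open>The second component of \<open>\<theta>\<inverse> e\<close>. It is written through the fiber over \<open>P e\<close> so that over the
  base point it is the identification of the fiber with \<open>F\<close> used in \<open>Sf_action\<close>.\<close>

definition fiber_coordinate ::
  "'f topology \<Rightarrow> ('e \<Rightarrow> 'b) \<Rightarrow> ('b \<times> 'f \<Rightarrow> 'e) \<Rightarrow> 'e \<Rightarrow> 'f" where
  "fiber_coordinate F P \<theta> e = inv_into (topspace F) (\<lambda>y. \<theta> (P e, y)) e"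

context
  fixes E :: "'e topology" and P :: "'e \<Rightarrow> 'b" and B :: "'b topology" and F :: "'f topology"
    and V :: "'b set" and \<theta> :: "'b \<times> 'f \<Rightarrow> 'e"
  assumes triv: "trivialization E P B F V \<theta>" and V: "V \<subseteq> topspace B"
begin

lemma trivialization_inj: "inj_on \<theta> (V \<times> topspace F)"
proof -
  have "inj_on \<theta> (topspace (prod_topology (subtopology B V) F))"
    using triv homeomorphic_imp_injective_map unfolding trivialization_def by blast
  then show ?thesis
    using V by (simp add: inf.absorb2)
qed

lemma trivialization_image: "\<theta> ` (V \<times> topspace F) = {e \<in> topspace E. P e \<in> V}"
proof -
  have "\<theta> ` topspace (prod_topology (subtopology B V) F)
      = topspace (subtopology E {e \<in> topspace E. P e \<in> V})"
    using triv homeomorphic_imp_surjective_map unfolding trivialization_def by blast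
  then show ?thesis
    using V by (simp add: inf.absorb2 Collect_conj_eq)
qed

lemma trivialization_mem:
  assumes "b \<in> V" "y \<in> topspace F"
  shows "\<theta> (b, y) \<in> topspace E" "P (\<theta> (b, y)) = b"
  using assms trivialization_image triv unfolding trivialization_def by blast+

lemma fiber_coordinate_trivialization:
  assumes "b \<in> V" "y \<in> topspace F"
  shows "fiber_coordinate F P \<theta> (\<theta> (b, y)) = y"
proof -
  have "inj_on (\<lambda>z. \<theta> (b, z)) (topspace F)"
    using trivialization_inj assms(1) by (auto simp: inj_on_def)
  then show ?thesis
    using assms by (simp add: fiber_coordinate_def trivialization_mem inv_into_f_f[of "\<lambda>z. \<theta> (b, z)"])
qed

lemma trivialization_fiber_coordinate:
  assumes "e \<in> topspace E" "P e \<in> V"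
  shows "fiber_coordinate F P \<theta> e \<in> topspace F" "\<theta> (P e, fiber_coordinate F P \<theta> e) = e"
proof -
  have "e \<in> \<theta> ` (V \<times> topspace F)"
    using assms trivialization_image by blast
  then obtain b y where "b \<in> V" "y \<in> topspace F" "e = \<theta> (b, y)"
    by blast
  then show "fiber_coordinate F P \<theta> e \<in> topspace F" "\<theta> (P e, fiber_coordinate F P \<theta> e) = e"
    by (simp_all add: fiber_coordinate_trivialization trivialization_mem)
qed

lemma continuous_map_trivialization_slice:
  assumes "b \<in> V"
  shows "continuous_map F E (\<lambda>y. \<theta> (b, y))"
proof -
  have "continuous_map (prod_topology (subtopology B V) F)
      (subtopology E {e \<in> topspace E. P e \<in> V}) \<theta>"
    using triv homeomorphic_imp_continuous_map unfolding trivialization_def by blast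
  then have "continuous_map (prod_topology (subtopology B V) F) E \<theta>"
    by (rule continuous_map_into_fulltopology)
  moreover have "continuous_map F (prod_topology (subtopology B V) F) (Pair b)"
    using assms V by (intro continuous_map_pairedI) auto
  ultimately have "continuous_map F E (\<theta> \<circ> Pair b)"
    by (rule continuous_map_compose[rotated])
  then show ?thesis
    by (simp add: o_def)
qed

lemma continuous_map_fiber_coordinate:
  "continuous_map (subtopology E {e \<in> topspace E. P e \<in> V}) F (fiber_coordinate F P \<theta>)"
proof -
  obtain g where g: "homeomorphic_maps (prod_topology (subtopology B V) F)
      (subtopology E {e \<in> topspace E. P e \<in> V}) \<theta> g"
    using triv homeomorphic_map_maps unfolding trivialization_def by blast
  have "continuous_map (subtopology E {e \<in> topspace E. P e \<in> V}) F (snd \<circ> g)"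
    using g unfolding homeomorphic_maps_def by (intro continuous_map_snd_of) blast
  then show ?thesis
  proof (rule continuous_map_eq)
    fix e assume e: "e \<in> topspace (subtopology E {e \<in> topspace E. P e \<in> V})"
    then have "g e \<in> topspace (prod_topology (subtopology B V) F)"
      using g continuous_map_image_subset_topspace unfolding homeomorphic_maps_def by blast
    then have "fst (g e) \<in> V" "snd (g e) \<in> topspace F"
      by (auto simp: mem_Times_iff)
    then show "(snd \<circ> g) e = fiber_coordinate F P \<theta> e"
      using fiber_coordinate_trivialization[of "fst (g e)" "snd (g e)"] g e
      unfolding homeomorphic_maps_def by simp
  qed
qed

lemma continuous_map_fiber_coordinate_compose:
  assumes "continuous_map W E f" "\<And>z. z \<in> topspace W \<Longrightarrow> P (f z) \<in> V"
  shows "continuous_map W F (\<lambda>z. fiber_coordinate F P \<theta> (f z))"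
proof -
  have "continuous_map W (subtopology E {e \<in> topspace E. P e \<in> V}) f"
    using assms continuous_map_image_subset_topspace[OF assms(1)]
    by (intro continuous_map_into_subtopology) auto
  then have "continuous_map W F (fiber_coordinate F P \<theta> \<circ> f)"
    by (rule continuous_map_compose[OF _ continuous_map_fiber_coordinate])
  then show ?thesis
    by (simp add: o_def)
qed

lemma homeomorphic_maps_fiber:
  assumes b: "b \<in> V"
  shows "homeomorphic_maps F (subtopology E (fiber E P b))
    (\<lambda>y. \<theta> (b, y)) (fiber_coordinate F P \<theta>)"
  unfolding homeomorphic_maps_def
proof (intro conjI ballI)
  show "continuous_map F (subtopology E (fiber E P b)) (\<lambda>y. \<theta> (b, y))"
    using continuous_map_trivialization_slice[OF b] trivialization_mem[OF b]
    by (intro continuous_map_into_subtopology) (auto simp: fiber_def)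
  show "continuous_map (subtopology E (fiber E P b)) F (fiber_coordinate F P \<theta>)"
    by (rule continuous_map_fiber_coordinate_compose) (use b in \<open>auto simp: fiber_def\<close>)
  show "fiber_coordinate F P \<theta> (\<theta> (b, y)) = y" if "y \<in> topspace F" for y
    using b that by (rule fiber_coordinate_trivialization)
  show "\<theta> (b, fiber_coordinate F P \<theta> e) = e" if "e \<in> topspace (subtopology E (fiber E P b))" for e
    using that b trivialization_fiber_coordinate(2)[of e] by (auto simp: fiber_def)
qed

end

section \<open>The suspension and the conical map\<close>

lemma topspace_suspension:
  "topspace (suspension X x0) = susp_proj x0 ` (topspace X \<times> {0..1})"
  using quotient_imp_surjective_map[OF quotient_map_quotient_topology]
  unfolding suspension_def by (metis topspace_prod_topology topspace_euclidean_subtopology)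

lemma cone0_subset: "cone0 X x0 \<subseteq> topspace (suspension X x0)"
  unfolding cone0_def topspace_suspension by (intro image_mono) auto

lemma cone1_subset: "cone1 X x0 \<subseteq> topspace (suspension X x0)"
  unfolding cone1_def topspace_suspension by (intro image_mono) auto

lemma susp_incl_in_cones:
  assumes "x \<in> topspace X"
  shows "susp_incl x \<in> cone0 X x0" "susp_incl x \<in> cone1 X x0"
proof -
  have "susp_incl x = susp_proj x0 (x, 1/2)"
    by (simp add: susp_incl_def susp_proj_def)
  then show "susp_incl x \<in> cone0 X x0" "susp_incl x \<in> cone1 X x0"
    using assms unfolding cone0_def cone1_def by auto
qed

lemma continuous_map_susp_incl: "continuous_map X (suspension X x0) susp_incl"
proof -
  have "continuous_map X (prod_topology X unit_interval) (\<lambda>x. (x, 1/2))"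
    by (intro continuous_map_pairedI) auto
  moreover have "continuous_map (prod_topology X unit_interval) (suspension X x0) (susp_proj x0)"
    unfolding suspension_def by (intro quotient_imp_continuous_map quotient_map_quotient_topology)
  ultimately have "continuous_map X (suspension X x0) (susp_proj x0 \<circ> (\<lambda>x. (x, 1/2)))"
    by (rule continuous_map_compose)
  then show ?thesis
    by (rule continuous_map_eq) (simp add: susp_incl_def susp_proj_def)
qed

lemma contraction_in_space:
  assumes "contraction_to (subtopology S C) z H" "c \<in> C" "c \<in> topspace S" "t \<in> {0..1}"
  shows "H (c, t) \<in> C"
proof -
  have "continuous_map (prod_topology (subtopology S C) unit_interval) (subtopology S C) H"
    using assms(1) unfolding contraction_to_def by blast
  from continuous_map_image_subset_topspace[OF this] show ?thesis
    using assms(2-4) by auto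
qed

lemma continuous_map_contraction:
  assumes "contraction_to (subtopology S C) z H"
    and c: "continuous_map W S c" "\<And>w. w \<in> topspace W \<Longrightarrow> c w \<in> C"
    and t: "continuous_map W euclideanreal t" "\<And>w. w \<in> topspace W \<Longrightarrow> t w \<in> {0..1}"
  shows "continuous_map W S (\<lambda>w. H (c w, t w))"
proof -
  have "continuous_map (prod_topology (subtopology S C) unit_interval) (subtopology S C) H"
    using assms(1) unfolding contraction_to_def by blast
  then have H: "continuous_map (prod_topology (subtopology S C) unit_interval) S H"
    by (rule continuous_map_into_fulltopology)
  have "continuous_map W S (H \<circ> (\<lambda>w. (c w, t w)))"
    by (intro continuous_map_compose[OF _ H] continuous_map_pairedI continuous_map_into_subtopology)
      (use c t in auto)
  then show ?thesis
    by (simp add: o_def)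
qed

context
  fixes X :: "'x topology" and x0 :: 'x and H0 H1 :: "('x \<times> real) \<times> real \<Rightarrow> 'x \<times> real"
  assumes H0: "contraction_to (subtopology (suspension X x0) (cone0 X x0)) (susp_incl x0) H0"
    and H1: "contraction_to (subtopology (suspension X x0) (cone1 X x0)) (susp_incl x0) H1"
begin

lemma conical_map_apply:
  assumes "t \<in> {0..1}"
  shows "conical_map H0 H1 x t =
    (if t \<le> 1/2 then H1 (susp_incl x, 1 - 2 * t) else H0 (susp_incl x, 2 * t - 1))"
  using assms by (auto simp: conical_map_def path_join_def path_inverse_def contraction_path_def)

lemma contractions_susp_incl:
  assumes "x \<in> topspace X"
  shows "H0 (susp_incl x, 0) = susp_incl x" "H0 (susp_incl x, 1) = susp_incl x0"
    "H1 (susp_incl x, 0) = susp_incl x" "H1 (susp_incl x, 1) = susp_incl x0"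
  using H0 H1 susp_incl_in_cones[OF assms, of x0] cone0_subset[of X x0] cone1_subset[of X x0]
  unfolding contraction_to_def by auto

lemma conical_map_points:
  assumes "x \<in> topspace X"
  shows "conical_map H0 H1 x 0 = susp_incl x0" "conical_map H0 H1 x (1/2) = susp_incl x"
    "conical_map H0 H1 x 1 = susp_incl x0"
  using contractions_susp_incl[OF assms] by (simp_all add: conical_map_apply)

lemma conical_map_in_cone1:
  assumes "x \<in> topspace X" "t \<in> {0..1/2}"
  shows "conical_map H0 H1 x t \<in> cone1 X x0"
  using assms susp_incl_in_cones[OF assms(1), of x0] cone1_subset[of X x0]
  by (auto simp: conical_map_apply intro!: contraction_in_space[OF H1])

lemma conical_map_in_cone0:
  assumes x: "x \<in> topspace X" and t: "t \<in> {1/2..1}"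
  shows "conical_map H0 H1 x t \<in> cone0 X x0"
proof (cases "t = 1/2")
  case True
  then show ?thesis
    by (simp only: True conical_map_points(2)[OF x] susp_incl_in_cones(1)[OF x])
next
  case False
  then show ?thesis
    using assms susp_incl_in_cones[OF x, of x0] cone0_subset[of X x0]
    by (auto simp: conical_map_apply intro!: contraction_in_space[OF H0])
qed

text \<open>By the exponential law it suffices that \<open>\<psi> x t\<close> is jointly continuous, and this holds since it
  is pasted from two continuous maps on \<open>t \<le> 1/2\<close> and \<open>t \<ge> 1/2\<close> that both equal \<open>x\<close> at \<open>t = 1/2\<close>.\<close>

lemma continuous_map_conical_map:
  "continuous_map X (path_space (suspension X x0)) (conical_map H0 H1)"
proof -
  let ?S = "suspension X x0"
  let ?XI = "prod_topology X unit_interval"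
  let ?f = "\<lambda>p. if snd p \<le> 1/2 then H1 (susp_incl (fst p), 1 - 2 * snd p)
    else H0 (susp_incl (fst p), 2 * snd p - 1)"
  have t: "continuous_map ?XI euclideanreal snd"
    using continuous_map_snd continuous_map_into_fulltopology by blast
  have x: "continuous_map ?XI ?S (\<lambda>p. susp_incl (fst p))"
    using continuous_map_compose[OF continuous_map_fst continuous_map_susp_incl] by (simp add: o_def)
  have "continuous_map ?XI ?S ?f"
  proof (rule continuous_map_cases_le)
    show "continuous_map (subtopology ?XI {p \<in> topspace ?XI. snd p \<le> 1/2}) ?S
        (\<lambda>p. H1 (susp_incl (fst p), 1 - 2 * snd p))"
      by (intro continuous_map_contraction[OF H1] continuous_map_from_subtopology x
          continuous_map_diff continuous_map_real_mult t)
        (auto simp: susp_incl_in_cones)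
    show "continuous_map (subtopology ?XI {p \<in> topspace ?XI. 1/2 \<le> snd p}) ?S
        (\<lambda>p. H0 (susp_incl (fst p), 2 * snd p - 1))"
      by (intro continuous_map_contraction[OF H0] continuous_map_from_subtopology x
          continuous_map_diff continuous_map_real_mult t)
        (auto simp: susp_incl_in_cones)
    show "H1 (susp_incl (fst p), 1 - 2 * snd p) = H0 (susp_incl (fst p), 2 * snd p - 1)"
      if "p \<in> topspace ?XI" "snd p = 1/2" for p
    proof -
      have "fst p \<in> topspace X" "1 - 2 * snd p = 0" "2 * snd p - 1 = 0"
        using that by auto
      then show ?thesis
        using contractions_susp_incl[of "fst p"] by (simp only:)
    qed
  qed (auto intro: t)
  from continuous_map_curry[OF this] show ?thesis
  proof (rule continuous_map_eq)
    fix x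
    show "restrict (\<lambda>t. ?f (x, t)) (topspace unit_interval) = conical_map H0 H1 x"
    proof
      fix t show "restrict (\<lambda>t. ?f (x, t)) (topspace unit_interval) t = conical_map H0 H1 x t"
      proof (cases "t \<in> {0..1}")
        case True
        then show ?thesis
          by (simp add: conical_map_apply)
      next
        case False
        then have "restrict g {0..1} t = undefined" for g :: "real \<Rightarrow> 'x \<times> real"
          by (simp only: restrict_apply if_False)
        then show ?thesis
          by (simp only: conical_map_def path_join_def topspace_euclidean_subtopology)
      qed
    qed
  qed
qed

end

section \<open>The transport along the conical loops\<close>

theorem theorem2p4:
  fixes X :: "'x topology" and x0 :: 'x
    and E :: "'e topology" and P :: "'e \<Rightarrow> 'x \<times> real" and F :: "'f topology"
    and \<Lambda> :: "'e \<times> (real \<Rightarrow> 'x \<times> real) \<Rightarrow> real \<Rightarrow> 'e"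
    and \<epsilon>1 \<epsilon>2 :: "('x \<times> real) \<times> 'f \<Rightarrow> 'e"
    and \<mu> :: "'x \<Rightarrow> 'f \<Rightarrow> 'f"
    and H0 H1 :: "('x \<times> real) \<times> real \<Rightarrow> 'x \<times> real"
  defines "\<phi> \<equiv> Sf_action F (\<lambda>y. \<epsilon>1 (susp_incl x0, y)) \<Lambda>"
    and "\<psi> \<equiv> conical_map H0 H1"
  assumes "polyhedron_space X" and "x0 \<in> topspace X"
    and "fiber_bundle E P (suspension X x0) F"
    and "locally_compact_space F"
    and "lifting_function E P (suspension X x0) \<Lambda>"
    and "trivialization E P (suspension X x0) F (cone0 X x0) \<epsilon>1"
    and "trivialization E P (suspension X x0) F (cone1 X x0) \<epsilon>2"
    and "\<forall>y\<in>topspace F. \<epsilon>1 (susp_incl x0, y) = \<epsilon>2 (susp_incl x0, y)"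
    and "characteristic_map X F \<epsilon>1 \<epsilon>2 \<mu>"
    and "contraction_to (subtopology (suspension X x0) (cone0 X x0)) (susp_incl x0) H0"
    and "contraction_to (subtopology (suspension X x0) (cone1 X x0)) (susp_incl x0) H1"
  shows "homotopic_with (\<lambda>_. True) X (compact_open F F) (\<phi> \<circ> \<psi>) \<mu> \<and>
    ((\<forall>\<beta>\<in>topspace (loop_space (suspension X x0) (susp_incl x0)). \<forall>t\<in>{0..1}.
        homeomorphic_map (subtopology E (fiber E P (susp_incl x0)))
          (subtopology E (fiber E P (\<beta> t))) (\<lambda>e. \<Lambda> (e, \<beta>) t))
     \<longrightarrow> homotopic_with (\<lambda>_. True) X (homeo_group F) (\<phi> \<circ> \<psi>) \<mu>)"
proof -
  let ?S = "suspension X x0" and ?b = "susp_incl x0"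
  let ?j = "\<lambda>y. \<epsilon>1 (?b, y)"
  let ?K0 = "fiber_coordinate F P \<epsilon>1" and ?K1 = "fiber_coordinate F P \<epsilon>2"
  define l where "l t x y = \<Lambda> (?j y, \<psi> x) t" for t x y
  note x0 = assms(4) and \<Lambda> = assms(7) and agree = assms(10)
  note tr0 = assms(8) cone0_subset and tr1 = assms(9) cone1_subset
  note H = assms(12,13)
  have HF: "Hausdorff_space F"
    using assms(5) unfolding fiber_bundle_def by blast
  have \<mu>cont: "continuous_map X (homeo_group F) \<mu>"
    and \<mu>: "\<And>x y. x \<in> topspace X \<Longrightarrow> y \<in> topspace F \<Longrightarrow>
      \<epsilon>2 (susp_incl x, y) = \<epsilon>1 (susp_incl x, \<mu> x y)"
    using assms(11) unfolding characteristic_map_def by blast+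
  have \<mu>cont': "continuous_map X (compact_open F F) \<mu>"
    using \<mu>cont continuous_map_into_fulltopology unfolding homeo_group_def by blast
  have \<mu>homeo: "homeomorphic_map F F (\<mu> x)" and \<mu>ext: "\<mu> x \<in> extensional (topspace F)"
    if "x \<in> topspace X" for x
    using continuous_map_image_subset_topspace[OF \<mu>cont] that
    by (auto simp: homeo_group_def topspace_compact_open)
  have b0: "?b \<in> cone0 X x0" and b1: "?b \<in> cone1 X x0"
    using susp_incl_in_cones[OF x0] by blast+
  note jE = trivialization_mem[OF tr0 b0]
  have \<psi>cont: "continuous_map X (path_space ?S) \<psi>"
    unfolding \<psi>_def using H by (rule continuous_map_conical_map)
  then have \<psi>mem: "\<psi> x \<in> topspace (path_space ?S)" if "x \<in> topspace X" for x
    using continuous_map_image_subset_topspace that by blast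
  note \<psi>pts = conical_map_points[OF H, folded \<psi>_def]
  have lift: "l 0 x y = ?j y" "\<And>t. t \<in> {0..1} \<Longrightarrow> P (l t x y) = \<psi> x t"
    if "x \<in> topspace X" "y \<in> topspace F" for x y
    using \<Lambda> jE[OF that(2)] \<psi>mem[OF that(1)] \<psi>pts(1)[OF that(1)]
    unfolding lifting_function_def l_def by auto
  have lcont: "continuous_map (prod_topology (prod_topology unit_interval X) F) E
      (\<lambda>p. l (s (fst (fst p))) (snd (fst p)) (snd p))"
    if s: "continuous_map unit_interval unit_interval s" for s
    unfolding l_def
  proof (rule continuous_map_lift[OF \<Lambda>])
    let ?W = "prod_topology (prod_topology unit_interval X) F"
    show "continuous_map ?W E (\<lambda>p. ?j (snd p))"
      using continuous_map_compose[OF continuous_map_snd continuous_map_trivialization_slice[OF tr0 b0]]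
      by (simp add: o_def)
    have x: "continuous_map ?W X (snd \<circ> fst)" and t: "continuous_map ?W unit_interval (fst \<circ> fst)"
      by (intro continuous_map_compose[OF continuous_map_fst] continuous_map_fst continuous_map_snd)+
    show "continuous_map ?W (path_space ?S) (\<lambda>p. \<psi> (snd (fst p)))"
      using continuous_map_compose[OF x \<psi>cont] by (simp add: o_def)
    show "continuous_map ?W unit_interval (\<lambda>p. s (fst (fst p)))"
      using continuous_map_compose[OF t s] by (simp add: o_def)
    show "P (?j (snd p)) = \<psi> (snd (fst p)) 0" if "p \<in> topspace ?W" for p
      using that jE(2)[of "snd p"] \<psi>pts(1)[of "snd (fst p)"] by auto
  qed
  have lE: "l t x y \<in> topspace E" if "t \<in> {0..1}" "x \<in> topspace X" "y \<in> topspace F" for t x y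
  proof -
    have "continuous_map (prod_topology (prod_topology unit_interval X) F) E
      (\<lambda>p. l (fst (fst p)) (snd (fst p)) (snd p))"
      using lcont[of id] by simp
    from continuous_map_image_subset_topspace[OF this] show ?thesis
      using that by force
  qed
  have P1: "P (l t x y) \<in> cone1 X x0" if "t \<in> {0..1/2}" "x \<in> topspace X" "y \<in> topspace F" for t x y
    using lift(2)[OF that(2,3), of t] conical_map_in_cone1[OF H that(2,1)] that(1) by (simp add: \<psi>_def)
  have P0: "P (l t x y) \<in> cone0 X x0" if "t \<in> {1/2..1}" "x \<in> topspace X" "y \<in> topspace F" for t x y
    using lift(2)[OF that(2,3), of t] conical_map_in_cone0[OF H that(2,1)] that(1) by (simp add: \<psi>_def)
  \<comment> \<open>The two halves of the homotopy, each reparametrized to the whole unit interval.\<close>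
  define h1 where "h1 t x y = \<mu> x (?K1 (l (t/2) x y))" for t x y
  define h0 where "h0 t x y = ?K0 (l ((1 + t)/2) x y)" for t x y
  let ?W = "prod_topology (prod_topology unit_interval X) F"
  have half1: "continuous_map unit_interval unit_interval (\<lambda>t. t/2)"
    and half0: "continuous_map unit_interval unit_interval (\<lambda>t. (1 + t)/2)"
    by (auto intro!: continuous_intros)
  have h0cont: "continuous_map ?W F (\<lambda>((t, x), y). h0 t x y)"
    unfolding h0_def case_prod_unfold
    by (rule continuous_map_fiber_coordinate_compose[OF tr0 lcont[OF half0]]) (auto intro!: P0)
  have h1cont: "continuous_map ?W F (\<lambda>((t, x), y). h1 t x y)"
    unfolding h1_def case_prod_unfold
  proof (rule continuous_map_eval[OF assms(6) HF, where f = "\<lambda>p. \<mu> (snd (fst p))"])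
    have "continuous_map ?W X (snd \<circ> fst)"
      by (intro continuous_map_compose[OF continuous_map_fst] continuous_map_snd)
    from continuous_map_compose[OF this \<mu>cont']
    show "continuous_map ?W (compact_open F F) (\<lambda>p. \<mu> (snd (fst p)))"
      by (simp add: o_def)
    show "continuous_map ?W F (\<lambda>p. ?K1 (l (fst (fst p) / 2) (snd (fst p)) (snd p)))"
      by (rule continuous_map_fiber_coordinate_compose[OF tr1 lcont[OF half1]]) (auto intro!: P1)
  qed
  have start: "\<mu> x = restrict (h1 0 x) (topspace F)" if x: "x \<in> topspace X" for x
  proof
    fix y show "\<mu> x y = restrict (h1 0 x) (topspace F) y"
      using \<mu>ext[OF x] lift(1)[OF x] agree fiber_coordinate_trivialization[OF tr1 b1]
      by (cases "y \<in> topspace F") (auto simp: h1_def extensional_def)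
  qed
  have middle: "h1 1 x y = h0 0 x y" if x: "x \<in> topspace X" and y: "y \<in> topspace F" for x y
  proof -
    \<comment> \<open>The lift is now over \<open>x\<close>, where \<open>\<mu> x\<close> is the change from \<open>\<epsilon>2\<close>- to \<open>\<epsilon>1\<close>-coordinates.\<close>
    let ?e = "l (1/2) x y"
    have e: "?e \<in> topspace E" "P ?e = susp_incl x"
      using lE[OF _ x y] lift(2)[OF x y, of "1/2"] \<psi>pts(2)[OF x] by auto
    have z: "?K1 ?e \<in> topspace F" "\<epsilon>2 (susp_incl x, ?K1 ?e) = ?e"
      using trivialization_fiber_coordinate[OF tr1 e(1)] e(2) susp_incl_in_cones(2)[OF x] by auto
    have "\<mu> x (?K1 ?e) \<in> topspace F"
      using \<mu>homeo[OF x] z(1) homeomorphic_imp_surjective_map by blast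
    moreover have "?e = \<epsilon>1 (susp_incl x, \<mu> x (?K1 ?e))"
      using \<mu>[OF x z(1)] z(2) by simp
    ultimately have "?K0 ?e = \<mu> x (?K1 ?e)"
      using fiber_coordinate_trivialization[OF tr0 susp_incl_in_cones(1)[OF x]] by metis
    then show ?thesis
      by (simp add: h1_def h0_def)
  qed
  have finish: "(\<phi> \<circ> \<psi>) x = restrict (h0 1 x) (topspace F)" if x: "x \<in> topspace X" for x
  proof
    fix y show "(\<phi> \<circ> \<psi>) x y = restrict (h0 1 x) (topspace F) y"
      using lift(2)[OF x, of y 1] \<psi>pts(3)[OF x]
      by (cases "y \<in> topspace F")
        (auto simp: \<phi>_def Sf_action_def Sf_function_def h0_def fiber_coordinate_def l_def)
  qed
  \<comment> \<open>\<open>A\<close> will be the set of all maps for the first claim, and of all homeomorphisms for the second.\<close>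
  have homotopic: "homotopic_with (\<lambda>_. True) X (subtopology (compact_open F F) A) (\<phi> \<circ> \<psi>) \<mu>"
    if A1: "\<And>t x. t \<in> {0..1} \<Longrightarrow> x \<in> topspace X \<Longrightarrow> restrict (h1 t x) (topspace F) \<in> A"
      and A0: "\<And>t x. t \<in> {0..1} \<Longrightarrow> x \<in> topspace X \<Longrightarrow> restrict (h0 t x) (topspace F) \<in> A" for A
  proof -
    let ?m = "\<lambda>x. restrict (h0 0 x) (topspace F)"
    have "homotopic_with (\<lambda>_. True) X (subtopology (compact_open F F) A) \<mu> ?m"
      by (rule homotopic_with_curry[OF h1cont A1 start]) (use middle in \<open>auto simp: restrict_def\<close>)
    moreover have "homotopic_with (\<lambda>_. True) X (subtopology (compact_open F F) A) ?m (\<phi> \<circ> \<psi>)"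
      by (rule homotopic_with_curry[OF h0cont A0]) (simp_all only: finish)
    ultimately show ?thesis
      using homotopic_with_trans homotopic_with_symD by blast
  qed
  show ?thesis
  proof (intro conjI impI)
    show "homotopic_with (\<lambda>_. True) X (compact_open F F) (\<phi> \<circ> \<psi>) \<mu>"
      using homotopic[of UNIV] by simp
    assume *: "\<forall>\<beta>\<in>topspace (loop_space ?S ?b). \<forall>t\<in>{0..1}.
        homeomorphic_map (subtopology E (fiber E P ?b))
          (subtopology E (fiber E P (\<beta> t))) (\<lambda>e. \<Lambda> (e, \<beta>) t)"
    have jhomeo: "homeomorphic_map F (subtopology E (fiber E P ?b)) ?j"
      using homeomorphic_maps_fiber[OF tr0 b0] homeomorphic_maps_map by blast
    have lhomeo: "homeomorphic_map F (subtopology E (fiber E P (\<psi> x t))) (l t x)"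
      if t: "t \<in> {0..1}" and x: "x \<in> topspace X" for t x
    proof -
      have "\<psi> x \<in> topspace (loop_space ?S ?b)"
        using \<psi>mem[OF x] \<psi>pts[OF x] by (simp add: loop_space_def)
      then have "homeomorphic_map (subtopology E (fiber E P ?b))
          (subtopology E (fiber E P (\<psi> x t))) (\<lambda>e. \<Lambda> (e, \<psi> x) t)"
        using * t by blast
      from homeomorphic_map_compose[OF jhomeo this] show ?thesis
        by (simp add: o_def l_def[abs_def])
    qed
    have h0homeo: "homeomorphic_map F F (restrict (h0 t x) (topspace F))"
      if t: "t \<in> {0..1}" and x: "x \<in> topspace X" for t x
    proof -
      have "\<psi> x ((1 + t)/2) \<in> cone0 X x0"
        unfolding \<psi>_def by (rule conical_map_in_cone0[OF H x]) (use t in auto)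
      then have "homeomorphic_map (subtopology E (fiber E P (\<psi> x ((1 + t)/2)))) F ?K0"
        using homeomorphic_maps_fiber[OF tr0] homeomorphic_maps_map by blast
      moreover have "homeomorphic_map F (subtopology E (fiber E P (\<psi> x ((1 + t)/2)))) (l ((1 + t)/2) x)"
        by (rule lhomeo[OF _ x]) (use t in auto)
      ultimately have "homeomorphic_map F F (?K0 \<circ> l ((1 + t)/2) x)"
        by (rule homeomorphic_map_compose[rotated])
      then show ?thesis
        by (rule homeomorphic_map_eq) (simp add: h0_def)
    qed
    have h1homeo: "homeomorphic_map F F (restrict (h1 t x) (topspace F))"
      if t: "t \<in> {0..1}" and x: "x \<in> topspace X" for t x
    proof -
      have "\<psi> x (t/2) \<in> cone1 X x0"
        unfolding \<psi>_def by (rule conical_map_in_cone1[OF H x]) (use t in auto)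
      then have "homeomorphic_map (subtopology E (fiber E P (\<psi> x (t/2)))) F ?K1"
        using homeomorphic_maps_fiber[OF tr1] homeomorphic_maps_map by blast
      moreover have "homeomorphic_map F (subtopology E (fiber E P (\<psi> x (t/2)))) (l (t/2) x)"
        by (rule lhomeo[OF _ x]) (use t in auto)
      ultimately have "homeomorphic_map F F (?K1 \<circ> l (t/2) x)"
        by (rule homeomorphic_map_compose[rotated])
      from homeomorphic_map_compose[OF this \<mu>homeo[OF x]] show ?thesis
        by (rule homeomorphic_map_eq) (simp add: h1_def)
    qed
    show "homotopic_with (\<lambda>_. True) X (homeo_group F) (\<phi> \<circ> \<psi>) \<mu>"
      unfolding homeo_group_def by (rule homotopic) (simp_all only: mem_Collect_eq h0homeo h1homeo)
  qed
qed

end
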